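(* Let $X$ be a real Hilbert space and let $f,g\colon X\to\left]-\infty,+\infty\right]$ be proper lower semicontinuous convex functions. Let $T=T_{(\partial f,\partial g)}=\operatorname{Id}-\operatorname{Prox}_f+\operatorname{Prox}_g(2\operatorname{Prox}_f-\operatorname{Id})$. Then the following hold: (i) $\overline{\operatorname{ran}}(\operatorname{Id}-T)=\overline{(\operatorname{dom}f-\operatorname{dom}g)\cap(\operatorname{dom}f^*+\operatorname{dom}g^* )}$. (ii) $\overline{\operatorname{ran}}\,T=\overline{(\operatorname{dom}f-\operatorname{dom}g^* )\cap(\operatorname{dom}f^*+\operatorname{dom}g)}$.
   Context: $X$ is a real Hilbert space (possibly infinite-dimensional) with inner product $\langle\cdot,\cdot\rangle$. For a proper lower semicontinuous convex function $h$: $\operatorname{dom}h=\{x\in X : h(x)<+\infty\}$, $h^*(u)=\sup_{x\in X}(\langle x,u\rangle-h(x))$ is the Fenchel conjugate, $\partial h$ is the (convex) subdifferential operator, and $\operatorname{Prox}_h=(\operatorname{Id}+\partial h)^{-1}$ is the proximal mapping (single-valued and defined on all of $X$). Sums and differences of sets are Minkowski sums and differences; overlines denote norm closures, and $\overline{\operatorname{ran}}$ is the closure of the range. *)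

theory Defs
  imports "HOL-Analysis.Analysis"
begin

definition proper_fun :: "('a \<Rightarrow> ereal) \<Rightarrow> bool" where
  "proper_fun h \<longleftrightarrow> (\<forall>x. h x \<noteq> -\<infinity>) \<and> (\<exists>x. h x \<noteq> \<infinity>)"

text \<open>The filter is \<open>nhds x\<close>, not \<open>at x\<close>: the lower limit ranges over full neighbourhoods of \<open>x\<close>.\<close>

definition lsc_fun :: "('a::topological_space \<Rightarrow> ereal) \<Rightarrow> bool" where
  "lsc_fun h \<longleftrightarrow> (\<forall>x. h x \<le> Liminf (nhds x) h)"

text \<open>The library's \<open>convex_on\<close> only covers real-valued functions. The right-hand side
  below is never of the form \<open>\<infinity> - \<infinity>\<close> for functions that avoid \<open>-\<infinity>\<close>.\<close>

definition convex_fun :: "('a::real_vector \<Rightarrow> ereal) \<Rightarrow> bool" where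
  "convex_fun h \<longleftrightarrow> (\<forall>x y. \<forall>t::real. 0 < t \<and> t < 1 \<longrightarrow>
     h ((1 - t) *\<^sub>R x + t *\<^sub>R y) \<le> ereal (1 - t) * h x + ereal t * h y)"

definition edom :: "('a \<Rightarrow> ereal) \<Rightarrow> 'a set" where
  "edom h = {x. h x < \<infinity>}"

definition fenchel_conjugate :: "('a::real_inner \<Rightarrow> ereal) \<Rightarrow> 'a \<Rightarrow> ereal" where
  "fenchel_conjugate h u = (SUP x. ereal (x \<bullet> u) - h x)"

definition subdifferential :: "('a::real_inner \<Rightarrow> ereal) \<Rightarrow> 'a \<Rightarrow> 'a set" where
  "subdifferential h x = {u. \<forall>y. h x + ereal ((y - x) \<bullet> u) \<le> h y}"

text \<open>\<open>Prox h\<close> is the inverse of the set-valued operator \<open>Id + \<partial>h\<close>. For proper lower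
  semicontinuous convex \<open>h\<close> on a Hilbert space this inverse is single-valued with full domain,
  so the definite description is then well-defined.\<close>

definition Prox :: "('a::real_inner \<Rightarrow> ereal) \<Rightarrow> 'a \<Rightarrow> 'a" where
  "Prox h x = (THE p. x \<in> {p} + subdifferential h p)"

definition douglas_rachford :: "('a::real_inner \<Rightarrow> ereal) \<Rightarrow> ('a \<Rightarrow> ereal) \<Rightarrow> 'a \<Rightarrow> 'a" where
  "douglas_rachford f g x = x - Prox f x + Prox g (2 *\<^sub>R Prox f x - x)"

text \<open>On sets, \<open>+\<close> is the Minkowski sum but \<open>-\<close> is the set-theoretic difference.\<close>

definition minkowski_diff :: "'a::minus set \<Rightarrow> 'a set \<Rightarrow> 'a set" where
  "minkowski_diff A B = {a - b |a b. a \<in> A \<and> b \<in> B}"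

end

(* Write x - p = u with p = Prox f x, u a subgradient of f at p, and 2 p - x - q = v with
   q = Prox g (2 p - x), v a subgradient of g at q.  Then x - T x = p - q = u + v and
   T x = u + q = p - v, which gives both inclusions of the ranges.  For the reverse inclusions,
   let w lie in the intersection on the right and solve e x + (x - T x) = w (respectively
   e x + T x = w) for e > 0, which is possible because T and Id - T are nonexpansive.  As
   subdifferentials satisfy the Brezis-Haraux inequality (they are 3* monotone), e |x|^2 is
   bounded by a constant plus a multiple of e |x|, so e x tends to 0 as e does. *)
theory Submission
  imports Defs
begin

section \<open>Proximal mappings\<close>

lemma proper_fun_eq_ereal:
  assumes "proper_fun h" "y \<in> edom h"
  shows "h y = ereal (real_of_ereal (h y))"
  using assms by (cases "h y") (auto simp: proper_fun_def edom_def)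

lemma edomI: "h y \<le> ereal r \<Longrightarrow> y \<in> edom h"
  unfolding edom_def by (cases "h y") auto

lemma convex_fun_real:
  fixes h :: "'a::real_vector \<Rightarrow> ereal"
  assumes "proper_fun h" "convex_fun h" "y \<in> edom h" "z \<in> edom h" "0 < t" "t < 1"
  shows "h ((1 - t) *\<^sub>R y + t *\<^sub>R z)
    \<le> ereal ((1 - t) * real_of_ereal (h y) + t * real_of_ereal (h z))"
proof -
  obtain r s where rs: "h y = ereal r" "h z = ereal s"
    using proper_fun_eq_ereal assms by metis
  have "h ((1 - t) *\<^sub>R y + t *\<^sub>R z) \<le> ereal (1 - t) * h y + ereal t * h z"
    using assms unfolding convex_fun_def by blast
  then show ?thesis
    by (simp add: rs)
qed

lemma lsc_fun_eventually_gt: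
  assumes "lsc_fun h" "c < h x"
  shows "\<forall>\<^sub>F y in nhds x. c < h y"
  using assms le_Liminf_iff unfolding lsc_fun_def by metis

text \<open>Lower semicontinuity bounds \<open>h\<close> below on a ball around a point
  \<open>z\<close> of the domain, and convexity on segments from \<open>z\<close> lets
  \<open>h\<close> fall at most linearly outside it. This growth bound takes the place of a
  continuous affine minorant, so no separation argument is required.\<close>

lemma convex_lsc_affine_lower_bound:
  fixes h :: "'a::real_normed_vector \<Rightarrow> ereal"
  assumes h: "proper_fun h" "lsc_fun h" "convex_fun h"
  obtains z \<alpha> \<beta> where "\<beta> \<ge> 0" "\<And>y. y \<in> edom h \<Longrightarrow> \<alpha> - \<beta> * norm (y - z) \<le> real_of_ereal (h y)"
proof -
  obtain z where z: "z \<in> edom h"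
    using h(1) by (auto simp: proper_fun_def edom_def)
  define c where "c = real_of_ereal (h z)"
  have hz: "h z = ereal c"
    using proper_fun_eq_ereal[OF h(1) z] by (simp add: c_def)
  have "\<forall>\<^sub>F y in nhds z. ereal (c - 1) < h y"
    using h(2) by (rule lsc_fun_eventually_gt) (simp add: hz)
  then obtain d where d: "d > 0" "\<And>y. dist y z < d \<Longrightarrow> ereal (c - 1) < h y"
    by (auto simp: eventually_nhds_metric)
  have "(c - 1) - 2 / d * norm (y - z) \<le> real_of_ereal (h y)" if y: "y \<in> edom h" for y
  proof (cases "dist y z < d")
    case True
    obtain r where "h y = ereal r"
      using proper_fun_eq_ereal[OF h(1) y] by blast
    then have "c - 1 < real_of_ereal (h y)"
      using d(2)[OF True] by simp
    moreover have "2 / d * norm (y - z) \<ge> 0"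
      using d by simp
    ultimately show ?thesis by linarith
  next
    case False
    define n where "n = norm (y - z)"
    have n: "n \<ge> d" "n > 0"
      using False d by (auto simp: n_def dist_norm)
    \<comment> \<open>This \<open>t\<close> puts \<open>s\<close>, on the segment from
      \<open>z\<close> to \<open>y\<close>, at distance \<open>d / 2\<close> from \<open>z\<close>,
      inside the ball where the local bound holds.\<close>
    define t where "t = d / (2 * n)"
    have t: "0 < t" "t < 1"
      using n d by (auto simp: t_def)
    define s where "s = (1 - t) *\<^sub>R z + t *\<^sub>R y"
    have "s - z = t *\<^sub>R (y - z)"
      by (simp add: s_def algebra_simps)
    then have "dist s z = t * n"
      using t by (simp add: dist_norm n_def)
    also have "\<dots> < d"
      using n d by (simp add: t_def)
    finally have "ereal (c - 1) < h s"
      using d(2) by blast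
    also have "h s \<le> ereal ((1 - t) * c + t * real_of_ereal (h y))"
      unfolding s_def c_def by (rule convex_fun_real[OF h(1,3) z y t])
    finally have "c - 1 < (1 - t) * c + t * real_of_ereal (h y)"
      by simp
    then have "-1 < t * (real_of_ereal (h y) - c)"
      by (simp add: algebra_simps)
    then have "-1 / t < real_of_ereal (h y) - c"
      using pos_divide_less_eq[OF t(1)] by (metis mult.commute)
    moreover have "1 / t = 2 / d * n"
      using n d by (simp add: t_def)
    ultimately show ?thesis
      by (simp add: n_def)
  qed
  then show ?thesis
    using that[of "2 / d" "c - 1" z] d by auto
qed

section \<open>Existence and optimality of the proximal point\<close>

lemma norm_midpoint_diff_sq:
  fixes x y z :: "'a::real_inner"
  shows "(norm ((1 - 1/2) *\<^sub>R y + (1/2) *\<^sub>R z - x))\<^sup>2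
    = (norm (y - x))\<^sup>2 / 2 + (norm (z - x))\<^sup>2 / 2 - (norm (y - z))\<^sup>2 / 4"
  unfolding power2_norm_eq_inner
  by (simp add: inner_simps algebra_simps inner_commute) (simp add: field_simps)

text \<open>Minimises \<open>y \<mapsto> h y + \<parallel>y - x\<parallel>\<^sup>2 / 2\<close>: by the parallelogram law, minimising sequences
  are Cauchy.\<close>

lemma prox_minimizer_exists:
  fixes h :: "'a::{real_inner, complete_space} \<Rightarrow> ereal"
  assumes h: "proper_fun h" "lsc_fun h" "convex_fun h"
  obtains p where "p \<in> edom h"
    "\<And>y. y \<in> edom h \<Longrightarrow> real_of_ereal (h p) + (norm (p - x))\<^sup>2 / 2
      \<le> real_of_ereal (h y) + (norm (y - x))\<^sup>2 / 2"
proof -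
  define H where "H = (\<lambda>y. real_of_ereal (h y))"
  define \<phi> where "\<phi> = (\<lambda>y. H y + (norm (y - x))\<^sup>2 / 2)"
  have hH: "h y = ereal (H y)" if "y \<in> edom h" for y
    using proper_fun_eq_ereal[OF h(1) that] by (simp add: H_def)
  have ne: "edom h \<noteq> {}"
    using h(1) by (auto simp: proper_fun_def edom_def)
  obtain z \<alpha> \<beta> where b: "\<beta> \<ge> 0" "\<And>y. y \<in> edom h \<Longrightarrow> \<alpha> - \<beta> * norm (y - z) \<le> real_of_ereal (h y)"
    by (rule convex_lsc_affine_lower_bound[OF h]) (rule that)
  have "\<alpha> - \<beta> * norm (x - z) - \<beta>\<^sup>2 / 2 \<le> \<phi> y" if "y \<in> edom h" for y
  proof -
    have "norm (y - z) \<le> norm (y - x) + norm (x - z)"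
      using norm_triangle_ineq[of "y - x" "x - z"] by simp
    then have "\<beta> * norm (y - z) \<le> \<beta> * norm (y - x) + \<beta> * norm (x - z)"
      using b(1) mult_left_mono by (fastforce simp flip: distrib_left)
    \<comment> \<open>The quadratic term absorbs the linear decay of \<open>h\<close>, at the price
      of the constant \<open>\<beta>\<^sup>2 / 2\<close>.\<close>
    moreover have "2 * (\<beta> * norm (y - x)) \<le> (norm (y - x))\<^sup>2 + \<beta>\<^sup>2"
      using sum_squares_bound[of \<beta> "norm (y - x)"] by (simp only: mult.assoc add.commute)
    ultimately show ?thesis
      using b(2)[OF that] unfolding \<phi>_def H_def by linarith
  qed
  then have bdd: "bdd_below (\<phi> ` edom h)"
    by (rule bdd_belowI2)
  define m where "m = Inf (\<phi> ` edom h)"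
  have m_le: "m \<le> \<phi> y" if "y \<in> edom h" for y
    unfolding m_def by (rule cInf_lower[OF imageI[OF that] bdd])
  have "\<exists>y \<in> edom h. \<phi> y < m + inverse (real (Suc n))" for n
  proof -
    have "Inf (\<phi> ` edom h) < m + inverse (real (Suc n))"
      by (simp add: m_def)
    then show ?thesis
      by (subst (asm) cInf_less_iff[OF _ bdd]) (use ne in auto)
  qed
  then obtain X where X: "\<And>n. X n \<in> edom h" "\<And>n. \<phi> (X n) < m + inverse (real (Suc n))"
    by metis
  \<comment> \<open>The midpoint also has value at least \<open>m\<close>, so the gain from the
    parallelogram law is bounded by the excess of the two values over \<open>m\<close>.\<close>
  have mid: "(norm (y - z))\<^sup>2 \<le> 4 * (\<phi> y - m) + 4 * (\<phi> z - m)"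
    if y: "y \<in> edom h" and z: "z \<in> edom h" for y z
  proof -
    define s where "s = (1 - 1/2) *\<^sub>R y + (1/2) *\<^sub>R z"
    have hs: "h s \<le> ereal ((1 - 1/2) * H y + (1/2) * H z)"
      unfolding s_def H_def by (rule convex_fun_real[OF h(1,3) y z]) auto
    then have s: "s \<in> edom h"
      by (rule edomI)
    have "H s \<le> H y / 2 + H z / 2"
      using hs by (simp add: hH[OF s])
    then have "\<phi> s \<le> \<phi> y / 2 + \<phi> z / 2 - (norm (y - z))\<^sup>2 / 8"
      using norm_midpoint_diff_sq[of y z x, folded s_def] by (simp add: \<phi>_def field_simps)
    with m_le[OF s] show ?thesis by simp
  qed
  have inv0: "(\<lambda>n. inverse (real (Suc n))) \<longlonglongrightarrow> 0"
    by (rule LIMSEQ_inverse_real_of_nat)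
  have "Cauchy X"
  proof (rule metric_CauchyI)
    fix e :: real assume e: "e > 0"
    \<comment> \<open>The two terms of \<open>mid\<close> carry a factor 4 each, so excesses below
      \<open>e\<^sup>2 / 8\<close> add up to less than \<open>e\<^sup>2\<close>.\<close>
    then have "\<forall>\<^sub>F n in sequentially. inverse (real (Suc n)) < e\<^sup>2 / 8"
      using order_tendstoD(2)[OF inv0, of "e\<^sup>2 / 8"] by simp
    then obtain M where M: "\<And>n. n \<ge> M \<Longrightarrow> inverse (real (Suc n)) < e\<^sup>2 / 8"
      by (auto simp: eventually_sequentially)
    have "dist (X i) (X j) < e" if "i \<ge> M" "j \<ge> M" for i j
    proof -
      have "\<phi> (X i) - m < e\<^sup>2 / 8" "\<phi> (X j) - m < e\<^sup>2 / 8"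
        using X(2)[of i] X(2)[of j] M[OF that(1)] M[OF that(2)] by simp_all
      with mid[OF X(1) X(1), of i j] have "(norm (X i - X j))\<^sup>2 < e\<^sup>2"
        by (simp add: field_simps)
      then show ?thesis
        using e by (simp add: dist_norm power2_less_imp_less)
    qed
    then show "\<exists>M. \<forall>m\<ge>M. \<forall>n\<ge>M. dist (X m) (X n) < e"
      by blast
  qed
  then obtain p where p: "X \<longlonglongrightarrow> p"
    using Cauchy_convergent convergent_def by blast
  define L where "L = m - (norm (p - x))\<^sup>2 / 2"
  define b where "b = (\<lambda>n. m + inverse (real (Suc n)) - (norm (X n - x))\<^sup>2 / 2)"
  have "b \<longlonglongrightarrow> m + 0 - (norm (p - x))\<^sup>2 / 2"
    unfolding b_def by (intro tendsto_intros inv0 p) simp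
  then have bL: "b \<longlonglongrightarrow> L"
    by (simp add: L_def)
  \<comment> \<open>The values \<open>H (X n)\<close> lie below \<open>b n\<close>, which tends to
    \<open>L\<close>; lower semicontinuity passes this to \<open>p\<close>. Finiteness of
    \<open>h p\<close> is a consequence, not an assumption.\<close>
  have hp: "h p \<le> ereal L"
  proof (rule ccontr)
    assume "\<not> h p \<le> ereal L"
    then obtain c where c: "ereal L < ereal c" "ereal c < h p"
      using ereal_dense2[of "ereal L" "h p"] by (metis linorder_not_le)
    have "\<forall>\<^sub>F n in sequentially. ereal c < h (X n)"
      using eventually_compose_filterlim[OF lsc_fun_eventually_gt[OF h(2) c(2)] p] .
    moreover have "\<forall>\<^sub>F n in sequentially. b n < c"
      using order_tendstoD(2)[OF bL] c(1) by simp
    ultimately have "\<forall>\<^sub>F n in sequentially. False"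
    proof eventually_elim
      case (elim n)
      then have "c < H (X n)"
        by (simp add: hH[OF X(1)])
      with elim X(2)[of n] show False
        by (simp add: b_def \<phi>_def)
    qed
    then show False by simp
  qed
  then have pd: "p \<in> edom h"
    by (rule edomI)
  have "\<phi> p \<le> m"
    using hp by (simp add: hH[OF pd] L_def \<phi>_def)
  then have "\<phi> p \<le> \<phi> y" if "y \<in> edom h" for y
    using m_le[OF that] by linarith
  then show ?thesis
    using that[OF pd] by (simp add: \<phi>_def H_def)
qed

text \<open>Compare \<open>p\<close> with points of the segment towards \<open>y\<close>: convexity
  makes the change of \<open>h\<close> at most linear in the parameter \<open>t\<close>, while the
  squared norm differs from its linearization by order \<open>t\<close> squared. Dividing by
  \<open>t\<close> and letting it tend to 0 leaves the subgradient inequality.\<close>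

lemma prox_minimizer_subgradient:
  fixes h :: "'a::real_inner \<Rightarrow> ereal"
  assumes h: "proper_fun h" "convex_fun h" and p: "p \<in> edom h"
    and min: "\<And>y. y \<in> edom h \<Longrightarrow> real_of_ereal (h p) + (norm (p - x))\<^sup>2 / 2
      \<le> real_of_ereal (h y) + (norm (y - x))\<^sup>2 / 2"
  shows "x - p \<in> subdifferential h p"
  unfolding subdifferential_def
proof (intro CollectI allI)
  fix y
  show "h p + ereal ((y - p) \<bullet> (x - p)) \<le> h y"
  proof (cases "y \<in> edom h")
    case False
    then show ?thesis by (simp add: edom_def)
  next
    case y: True
    define A where "A = real_of_ereal (h p) + (y - p) \<bullet> (x - p) - real_of_ereal (h y)"
    define B where "B = (norm (y - p))\<^sup>2 / 2"
    have AB: "A \<le> t * B" if t: "0 < t" "t < 1" for t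
    proof -
      define s where "s = (1 - t) *\<^sub>R p + t *\<^sub>R y"
      have hs: "h s \<le> ereal ((1 - t) * real_of_ereal (h p) + t * real_of_ereal (h y))"
        unfolding s_def by (rule convex_fun_real[OF h p y t])
      then have s: "s \<in> edom h"
        by (rule edomI)
      obtain r where "h s = ereal r"
        using proper_fun_eq_ereal[OF h(1) s] by blast
      then have "real_of_ereal (h s) \<le> (1 - t) * real_of_ereal (h p) + t * real_of_ereal (h y)"
        using hs by simp
      moreover have "(norm (s - x))\<^sup>2 / 2
          = (norm (p - x))\<^sup>2 / 2 - t * ((y - p) \<bullet> (x - p)) + t * (t * B)"
      proof -
        have "s - x = t *\<^sub>R (y - p) - (x - p)"
          by (simp add: s_def algebra_simps)
        then have "(norm (s - x))\<^sup>2
            = t * (t * (norm (y - p))\<^sup>2) - 2 * (t * ((y - p) \<bullet> (x - p))) + (norm (x - p))\<^sup>2"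
          by (simp only: power2_norm_eq_inner)
            (simp only: inner_diff_left inner_diff_right inner_scaleR_left inner_scaleR_right,
              simp add: inner_commute algebra_simps)
        then show ?thesis
          by (simp add: B_def norm_minus_commute[of p x])
      qed
      ultimately have "t * A \<le> t * (t * B)"
        using min[OF s] by (simp add: A_def algebra_simps)
      then show ?thesis
        using t by simp
    qed
    have "((\<lambda>t. t * B) \<longlongrightarrow> 0 * B) (at_right 0)"
      by (intro tendsto_intros)
    moreover have "\<forall>\<^sub>F t in at_right 0. A \<le> t * B"
      unfolding eventually_at_right_field using AB by (intro exI[of _ 1]) simp
    ultimately have "A \<le> 0 * B"
      using tendsto_lowerbound trivial_limit_at_right_real by blast
    moreover obtain r s where "h p = ereal r" "h y = ereal s"
      using proper_fun_eq_ereal[OF h(1)] p y by blast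
    ultimately show ?thesis
      by (simp add: A_def)
  qed
qed

section \<open>Subgradients, proximal mappings and conjugates\<close>

lemma subdifferential_edom:
  assumes "proper_fun h" "u \<in> subdifferential h p"
  shows "p \<in> edom h"
proof -
  obtain y where "h y \<noteq> \<infinity>"
    using assms by (auto simp: proper_fun_def)
  moreover have "h p + ereal ((y - p) \<bullet> u) \<le> h y"
    using assms by (auto simp: subdifferential_def)
  ultimately show ?thesis
    by (cases "h p") (auto simp: edom_def)
qed

lemma subdifferential_real:
  assumes "proper_fun h" "u \<in> subdifferential h p" "y \<in> edom h"
  shows "real_of_ereal (h p) + (y - p) \<bullet> u \<le> real_of_ereal (h y)"
proof -
  have "h p + ereal ((y - p) \<bullet> u) \<le> h y"
    using assms by (auto simp: subdifferential_def)
  moreover obtain r s where "h p = ereal r" "h y = ereal s"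
    using proper_fun_eq_ereal[OF assms(1)] subdifferential_edom[OF assms(1,2)] assms(3) by blast
  ultimately show ?thesis
    by simp
qed

lemma subdifferential_monotone:
  assumes "proper_fun h" "u \<in> subdifferential h p" "v \<in> subdifferential h q"
  shows "(p - q) \<bullet> (u - v) \<ge> 0"
  using subdifferential_real[OF assms(1,2) subdifferential_edom[OF assms(1,3)]]
    subdifferential_real[OF assms(1,3) subdifferential_edom[OF assms(1,2)]]
  by (simp add: inner_simps)

text \<open>Makes the definite description usable: existence comes from the minimizer, uniqueness
  from monotonicity of the subdifferential. Everything later about \<open>Prox\<close> rests on this
  fact.\<close>

lemma Prox_subdifferential:
  fixes h :: "'a::{real_inner, complete_space} \<Rightarrow> ereal"
  assumes h: "proper_fun h" "lsc_fun h" "convex_fun h"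
  shows "x - Prox h x \<in> subdifferential h (Prox h x)"
proof -
  have iff: "x \<in> {p} + subdifferential h p \<longleftrightarrow> x - p \<in> subdifferential h p" for p
    by (force simp: set_plus_def)
  have "\<exists>!p. x - p \<in> subdifferential h p"
  proof (rule ex_ex1I)
    obtain p where "p \<in> edom h"
      "\<And>y. y \<in> edom h \<Longrightarrow> real_of_ereal (h p) + (norm (p - x))\<^sup>2 / 2
        \<le> real_of_ereal (h y) + (norm (y - x))\<^sup>2 / 2"
      by (rule prox_minimizer_exists[OF h, of x]) (rule that)
    then have "x - p \<in> subdifferential h p"
      by (rule prox_minimizer_subgradient[OF h(1,3)])
    then show "\<exists>p. x - p \<in> subdifferential h p" ..
  next
    fix p q assume "x - p \<in> subdifferential h p" "x - q \<in> subdifferential h q"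
    then have "(p - q) \<bullet> (q - p) \<ge> 0"
      using subdifferential_monotone[OF h(1), of "x - p" p "x - q" q] by simp
    then have "(p - q) \<bullet> (p - q) \<le> 0"
      by (simp add: inner_simps)
    then have "(p - q) \<bullet> (p - q) = 0"
      by (rule antisym) simp
    then show "p = q"
      by simp
  qed
  from theI'[OF this] show ?thesis
    unfolding Prox_def iff .
qed

text \<open>The subgradient inequality at \<open>p\<close> says that \<open>p\<close> attains the
  supremum defining the conjugate at \<open>u\<close>, and the value there is finite.\<close>

lemma subdifferential_edom_conjugate:
  assumes "proper_fun h" "u \<in> subdifferential h p"
  shows "u \<in> edom (fenchel_conjugate h)"
proof -
  have "ereal (y \<bullet> u) - h y \<le> ereal (p \<bullet> u - real_of_ereal (h p))" for y
  proof (cases "y \<in> edom h")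
    case False
    then show ?thesis by (simp add: edom_def)
  next
    case True
    have "y \<bullet> u - real_of_ereal (h y) \<le> p \<bullet> u - real_of_ereal (h p)"
      using subdifferential_real[OF assms True] by (simp add: inner_simps)
    moreover obtain r where "h y = ereal r"
      using proper_fun_eq_ereal[OF assms(1) True] by blast
    ultimately show ?thesis
      by simp
  qed
  then have "fenchel_conjugate h u \<le> ereal (p \<bullet> u - real_of_ereal (h p))"
    unfolding fenchel_conjugate_def by (rule SUP_least)
  then show ?thesis
    by (rule edomI)
qed

text \<open>The Brezis-Haraux inequality.\<close>

lemma subdifferential_three_star:
  fixes h :: "'a::real_inner \<Rightarrow> ereal"
  assumes h: "proper_fun h" and a: "a \<in> edom h" and c: "c \<in> edom (fenchel_conjugate h)"
  shows "\<exists>K. \<forall>p. \<forall>u \<in> subdifferential h p. - K \<le> (p - a) \<bullet> (u - c)"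
proof -
  define k where "k = real_of_ereal (fenchel_conjugate h c)"
  have young: "ereal (y \<bullet> c) - h y \<le> fenchel_conjugate h c" for y
    unfolding fenchel_conjugate_def by (rule SUP_upper) simp
  obtain r where "h a = ereal r"
    using proper_fun_eq_ereal[OF h a] by blast
  \<comment> \<open>Finiteness of \<open>h a\<close> keeps the conjugate above minus infinity;
    membership of \<open>c\<close> in its domain excludes plus infinity.\<close>
  then have k: "fenchel_conjugate h c = ereal k"
    using young[of a] c by (cases "fenchel_conjugate h c") (auto simp: k_def edom_def)
  \<comment> \<open>The constant is the Fenchel-Young gap of \<open>a\<close> and \<open>c\<close>,
    which does not depend on \<open>p\<close> or \<open>u\<close>. The subgradient inequality is
    tested at \<open>a\<close>, the Fenchel-Young inequality for \<open>c\<close> at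
    \<open>p\<close>.\<close>
  have "- (real_of_ereal (h a) + k - a \<bullet> c) \<le> (p - a) \<bullet> (u - c)"
    if u: "u \<in> subdifferential h p" for p u
  proof -
    obtain r where "h p = ereal r"
      using proper_fun_eq_ereal[OF h subdifferential_edom[OF h u]] by blast
    then have "p \<bullet> c - real_of_ereal (h p) \<le> k"
      using young[of p] k by simp
    then show ?thesis
      using subdifferential_real[OF h u a] by (simp add: inner_simps)
  qed
  then show ?thesis by blast
qed

section \<open>Approximate solutions\<close>

text \<open>Solving for the outer \<open>x\<close> rewrites the equation as a fixed point problem
  for a contraction with factor \<open>1 / (1 + e)\<close>, to which Banach's theorem
  applies.\<close>

lemma nonexpansive_regularized_solution:
  fixes S :: "'a::{real_normed_vector, complete_space} \<Rightarrow> 'a"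
  assumes S: "\<And>x y. norm (S x - S y) \<le> norm (x - y)" and e: "e > 0"
  obtains x where "e *\<^sub>R x + (x - S x) = w"
proof -
  define F where "F = (\<lambda>x. (1 / (1 + e)) *\<^sub>R (w + S x))"
  have "dist (F x) (F y) \<le> (1 / (1 + e)) * dist x y" for x y
  proof -
    have "F x - F y = (1 / (1 + e)) *\<^sub>R (S x - S y)"
      by (simp add: F_def algebra_simps)
    then have "dist (F x) (F y) = (1 / (1 + e)) * norm (S x - S y)"
      using e by (simp add: dist_norm)
    then show ?thesis
      using S[of x y] e by (simp add: dist_norm divide_right_mono)
  qed
  then have "\<exists>!x. F x = x"
    using e banach_fix_type[of "1 / (1 + e)" F] by simp
  then obtain x where x: "F x = x"
    by blast
  have "(1 + e) *\<^sub>R F x = w + S x"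
    using e by (simp add: F_def)
  then have "e *\<^sub>R x + (x - S x) = w"
    unfolding x by (simp add: algebra_simps)
  then show ?thesis by (rule that)
qed

text \<open>The residual \<open>w - N x\<close> equals \<open>e *\<^sub>R x\<close>. Multiplying the
  bound by \<open>e\<close> controls the square of \<open>e * norm x\<close> by terms with a factor
  \<open>e\<close>, so the residual can be made arbitrarily small.\<close>

lemma closure_range_regularized:
  fixes N :: "'a::real_normed_vector \<Rightarrow> 'a"
  assumes sol: "\<And>e. e > 0 \<Longrightarrow> \<exists>x. e *\<^sub>R x + N x = w"
    and bound: "\<And>e x. e > 0 \<Longrightarrow> e *\<^sub>R x + N x = w \<Longrightarrow> e * (norm x)\<^sup>2 \<le> K + e * norm x * r"
    and "r \<ge> 0"
  shows "w \<in> closure (range N)"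
  unfolding closure_approachable
proof (intro allI impI)
  fix d :: real assume d: "d > 0"
  define C where "C = \<bar>K\<bar> / d + r"
  have C: "C \<ge> 0"
    using d \<open>r \<ge> 0\<close> by (simp add: C_def)
  define e where "e = d / (C + 1)"
  have e: "e > 0"
    using d C by (simp add: e_def)
  obtain x where x: "e *\<^sub>R x + N x = w"
    using sol[OF e] by blast
  define y where "y = e * norm x"
  have "y < d"
  proof (rule ccontr)
    assume "\<not> y < d"
    then have y: "y \<ge> d" "y > 0"
      using d by auto
    \<comment> \<open>Under the contrary assumption \<open>y \<ge> d\<close>, the constant becomes a
      multiple of \<open>y\<close>; the bound is then linear in \<open>y\<close> with the
      coefficient \<open>C\<close>, and \<open>e\<close> was chosen so that
      \<open>e * C < d\<close>.\<close>
    have "\<bar>K\<bar> \<le> \<bar>K\<bar> / d * y"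
      using mult_left_mono[OF y(1), of "\<bar>K\<bar> / d"] d by simp
    then have "e * (norm x)\<^sup>2 \<le> C * y"
      using bound[OF e x] by (simp add: C_def y_def algebra_simps)
    then have "e * (e * (norm x)\<^sup>2) \<le> e * (C * y)"
      using e by simp
    then have "y * y \<le> (e * C) * y"
      by (simp add: y_def power2_eq_square algebra_simps)
    then have "y \<le> e * C"
      using y by simp
    moreover have "e * C < d"
      using d C by (simp add: e_def field_simps)
    ultimately show False
      using y by simp
  qed
  moreover have "dist (N x) w = y"
    using e by (simp add: x[symmetric] dist_norm y_def)
  ultimately show "\<exists>z\<in>range N. dist z w < d"
    by blast
qed

text \<open>Eliminating \<open>\<beta>\<close> and \<open>\<delta>\<close> cancels the product of
  \<open>\<alpha>\<close> and \<open>\<gamma>\<close>.\<close>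

lemma inner_sum_regularized:
  fixes \<alpha> \<beta> \<gamma> \<delta> z :: "'a::real_inner"
  assumes "\<alpha> - \<beta> = - z" "\<gamma> + \<delta> = - z"
  shows "\<alpha> \<bullet> \<gamma> + \<beta> \<bullet> \<delta> = - (z \<bullet> (\<alpha> + \<gamma>)) - z \<bullet> z"
proof -
  have "\<beta> = \<alpha> + z" "\<delta> = - z - \<gamma>"
    using assms by (simp_all add: algebra_simps)
  then show ?thesis
    by (simp only:) (simp add: inner_simps inner_commute algebra_simps)
qed

text \<open>Adds the Brezis-Haraux bounds for \<open>f\<close> and \<open>g\<close>. Leaving
  \<open>\<beta>\<close> and \<open>\<delta>\<close> abstract serves both ranges, where the point
  and the subgradient of \<open>g\<close> exchange roles.\<close>

lemma three_star_regularized_bound: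
  fixes x p u \<beta> \<delta> :: "'a::real_inner"
  assumes "e > 0" "x = p + u" "(p - a) - \<beta> = - (e *\<^sub>R x)" "(u - c) + \<delta> = - (e *\<^sub>R x)"
    and "- K \<le> (p - a) \<bullet> (u - c)" "- K' \<le> \<beta> \<bullet> \<delta>"
  shows "e * (norm x)\<^sup>2 \<le> (K + K') + e * norm x * norm (a + c)"
proof -
  have "(p - a) + (u - c) = x - (a + c)"
    using assms(2) by simp
  then have "- (K + K') \<le> - (e *\<^sub>R x \<bullet> (x - (a + c))) - e *\<^sub>R x \<bullet> e *\<^sub>R x"
    using assms(5,6) inner_sum_regularized[OF assms(3,4)] by (simp only:)
  then have "- (K + K') \<le> - (e * (norm x)\<^sup>2) + e * (x \<bullet> (a + c)) - (norm (e *\<^sub>R x))\<^sup>2"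
    unfolding power2_norm_eq_inner by (simp add: inner_diff_right algebra_simps)
  moreover have "e * (x \<bullet> (a + c)) \<le> e * (norm x * norm (a + c))"
    using assms(1) norm_cauchy_schwarz by simp
  ultimately show ?thesis
    using zero_le_power2[of "norm (e *\<^sub>R x)"] by (simp only: mult.assoc)
qed

section \<open>The range of the Douglas--Rachford operator\<close>

text \<open>After expansion, the right side minus the left side is exactly twice the sum of the two
  monotonicity products, one for \<open>f\<close> and one for \<open>g\<close>.\<close>

lemma douglas_rachford_firmly_nonexpansive:
  fixes f g :: "'a::{real_inner, complete_space} \<Rightarrow> ereal"
  assumes f: "proper_fun f" "lsc_fun f" "convex_fun f"
    and g: "proper_fun g" "lsc_fun g" "convex_fun g"
  defines "T \<equiv> douglas_rachford f g"
  shows "(norm (T x - T y))\<^sup>2 + (norm ((x - T x) - (y - T y)))\<^sup>2 \<le> (norm (x - y))\<^sup>2"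
proof -
  define p where "p = (\<lambda>x. Prox f x)"
  define q where "q = (\<lambda>x. Prox g (2 *\<^sub>R p x - x))"
  have "(p x - p y) \<bullet> ((x - p x) - (y - p y)) \<ge> 0"
    unfolding p_def by (intro subdifferential_monotone[OF f(1)] Prox_subdifferential f)
  moreover have "(q x - q y) \<bullet> ((2 *\<^sub>R p x - x - q x) - (2 *\<^sub>R p y - y - q y)) \<ge> 0"
    unfolding q_def by (intro subdifferential_monotone[OF g(1)] Prox_subdifferential g)
  moreover have T: "T z = z - p z + q z" for z
    by (simp add: T_def douglas_rachford_def p_def q_def)
  ultimately show ?thesis
    unfolding T
    unfolding power2_norm_eq_inner by (simp add: inner_simps inner_commute algebra_simps)
qed

theorem theorem3p3:
  fixes f g :: "'a::{real_inner, complete_space} \<Rightarrow> ereal"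
  assumes "proper_fun f" and "lsc_fun f" and "convex_fun f"
    and "proper_fun g" and "lsc_fun g" and "convex_fun g"
  shows "closure (range (\<lambda>x. x - douglas_rachford f g x)) =
      closure (minkowski_diff (edom f) (edom g) \<inter>
        (edom (fenchel_conjugate f) + edom (fenchel_conjugate g)))
    \<and> closure (range (douglas_rachford f g)) =
      closure (minkowski_diff (edom f) (edom (fenchel_conjugate g)) \<inter>
        (edom (fenchel_conjugate f) + edom g))"
proof -
  define T where "T = douglas_rachford f g"
  define p where "p = (\<lambda>x. Prox f x)"
  define q where "q = (\<lambda>x. Prox g (2 *\<^sub>R p x - x))"
  define u where "u = (\<lambda>x. x - p x)"
  define v where "v = (\<lambda>x. 2 *\<^sub>R p x - x - q x)"
  have u: "u x \<in> subdifferential f (p x)" for x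
    unfolding u_def p_def by (intro Prox_subdifferential assms)
  have v: "v x \<in> subdifferential g (q x)" for x
    unfolding v_def q_def by (intro Prox_subdifferential assms)
  have T: "T x = x - p x + q x" for x
    by (simp add: T_def douglas_rachford_def p_def q_def)
  have x_eq: "x = p x + u x" for x
    by (simp add: u_def)
  have N1: "x - T x = p x - q x" and N2: "x - T x = u x + v x"
    and T1: "T x = p x - v x" and T2: "T x = u x + q x" for x
    by (simp_all add: T u_def v_def scaleR_2)
  have dom: "p x \<in> edom f" "q x \<in> edom g"
    "u x \<in> edom (fenchel_conjugate f)" "v x \<in> edom (fenchel_conjugate g)" for x
    using subdifferential_edom[OF assms(1) u] subdifferential_edom[OF assms(4) v]
      subdifferential_edom_conjugate[OF assms(1) u] subdifferential_edom_conjugate[OF assms(4) v]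
    by auto
  have firm: "(norm (T x - T y))\<^sup>2 + (norm ((x - T x) - (y - T y)))\<^sup>2 \<le> (norm (x - y))\<^sup>2" for x y
    unfolding T_def by (rule douglas_rachford_firmly_nonexpansive[OF assms])
  \<comment> \<open>Dropping one square or the other makes both \<open>T\<close> and
    \<open>Id - T\<close> nonexpansive.\<close>
  have neT: "norm (T x - T y) \<le> norm (x - y)" for x y
    using order_trans[OF _ firm[of x y]] by (rule power2_le_imp_le) simp_all
  have neN: "norm ((x - T x) - (y - T y)) \<le> norm (x - y)" for x y
    using order_trans[OF _ firm[of x y]] by (rule power2_le_imp_le) simp_all
  have "closure (range (\<lambda>x. x - T x)) = closure (minkowski_diff (edom f) (edom g) \<inter>
        (edom (fenchel_conjugate f) + edom (fenchel_conjugate g)))" (is "closure ?R = closure ?S")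
  proof
    have "x - T x \<in> minkowski_diff (edom f) (edom g)" for x
      using dom[of x] by (auto simp: N1 minkowski_diff_def)
    moreover have "x - T x \<in> edom (fenchel_conjugate f) + edom (fenchel_conjugate g)" for x
      using dom[of x] by (auto simp: N2)
    ultimately show "closure ?R \<subseteq> closure ?S"
      by (intro closure_mono) blast
    have "w \<in> closure ?R" if w_in: "w \<in> ?S" for w
    proof -
      \<comment> \<open>Both representations of \<open>w\<close> are used: \<open>a\<close> and
        \<open>c\<close> serve as reference pair for \<open>f\<close>, \<open>b\<close> and
        \<open>d\<close> for \<open>g\<close>.\<close>
      obtain a b c d where w: "a \<in> edom f" "b \<in> edom g" "w = a - b"
        "c \<in> edom (fenchel_conjugate f)" "d \<in> edom (fenchel_conjugate g)" "w = c + d"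
        using w_in unfolding minkowski_diff_def set_plus_def by blast
      obtain K where K: "\<And>x. - K \<le> (p x - a) \<bullet> (u x - c)"
        using subdifferential_three_star[OF assms(1) w(1,4)] u by blast
      obtain K' where K': "\<And>x. - K' \<le> (q x - b) \<bullet> (v x - d)"
        using subdifferential_three_star[OF assms(4) w(2,5)] v by blast
      show ?thesis
      proof (rule closure_range_regularized)
        fix e :: real assume e: "e > 0"
        show "\<exists>x. e *\<^sub>R x + (x - T x) = w"
          using nonexpansive_regularized_solution[of T e w, OF neT e] by blast
        fix x assume x: "e *\<^sub>R x + (x - T x) = w"
        have "(p x - a) - (q x - b) = - (e *\<^sub>R x)"
          using x unfolding N1 w(3) by (simp add: algebra_simps)
        moreover have "(u x - c) + (v x - d) = - (e *\<^sub>R x)"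
          using x unfolding N2 w(6) by (simp add: algebra_simps)
        ultimately show "e * (norm x)\<^sup>2 \<le> (K + K') + e * norm x * norm (a + c)"
          using K K' by (rule three_star_regularized_bound[OF e x_eq])
      qed simp
    qed
    then show "closure ?S \<subseteq> closure ?R"
      by (intro closure_minimal) auto
  qed
  moreover have "closure (range T) = closure (minkowski_diff (edom f) (edom (fenchel_conjugate g)) \<inter>
        (edom (fenchel_conjugate f) + edom g))" (is "closure ?R = closure ?S")
  proof
    have "T x \<in> minkowski_diff (edom f) (edom (fenchel_conjugate g))" for x
      using dom[of x] by (auto simp: T1 minkowski_diff_def)
    moreover have "T x \<in> edom (fenchel_conjugate f) + edom g" for x
      using dom[of x] by (auto simp: T2)
    ultimately show "closure ?R \<subseteq> closure ?S"
      by (intro closure_mono) blast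
    have "w \<in> closure ?R" if w_in: "w \<in> ?S" for w
    proof -
      obtain a b c d where w: "a \<in> edom f" "d \<in> edom (fenchel_conjugate g)" "w = a - d"
        "c \<in> edom (fenchel_conjugate f)" "b \<in> edom g" "w = c + b"
        using w_in unfolding minkowski_diff_def set_plus_def by blast
      obtain K where K: "\<And>x. - K \<le> (p x - a) \<bullet> (u x - c)"
        using subdifferential_three_star[OF assms(1) w(1,4)] u by blast
      obtain K' where "\<And>x. - K' \<le> (q x - b) \<bullet> (v x - d)"
        using subdifferential_three_star[OF assms(4) w(5,2)] v by blast
      \<comment> \<open>Here the subgradient of \<open>g\<close> is subtracted and its point is
        added, so the factors are swapped to fit the common estimate.\<close>
      then have K': "\<And>x. - K' \<le> (v x - d) \<bullet> (q x - b)"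
        by (subst inner_commute)
      show ?thesis
      proof (rule closure_range_regularized)
        fix e :: real assume e: "e > 0"
        show "\<exists>x. e *\<^sub>R x + T x = w"
          \<comment> \<open>With \<open>Id - T\<close> as the nonexpansive map, its complement is
            \<open>T\<close> itself.\<close>
          using nonexpansive_regularized_solution[of "\<lambda>x. x - T x" e w, OF neN e] by auto
        fix x assume x: "e *\<^sub>R x + T x = w"
        have "(p x - a) - (v x - d) = - (e *\<^sub>R x)"
          using x unfolding T1 w(3) by (simp add: algebra_simps)
        moreover have "(u x - c) + (q x - b) = - (e *\<^sub>R x)"
          using x unfolding T2 w(6) by (simp add: algebra_simps)
        ultimately show "e * (norm x)\<^sup>2 \<le> (K + K') + e * norm x * norm (a + c)"
          using K K' by (rule three_star_regularized_bound[OF e x_eq])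
      qed simp
    qed
    then show "closure ?S \<subseteq> closure ?R"
      by (intro closure_minimal) auto
  qed
  ultimately show ?thesis
    unfolding T_def ..
qed

end
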